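(* Let $W$ be a bounded below infinite subset of $\mathbb{Z}$ such that, writing the elements of $\mathbb{Z}_{\geq 1}\setminus W$ in increasing order as $\bar w_1<\bar w_2<\cdots$, one has $\lim_{i\to\infty}(\bar w_{i+1}-\bar w_i)=\infty$. Then $W$ admits neither a minimal complement nor a minimal asymptotic complement in $\mathbb{Z}$.
   Context: $\mathbb{Z}_{\ge 1}=\{n\in\mathbb{Z}: n\ge 1\}$. For nonempty $A,B\subseteq\mathbb{Z}$, $A+B=\{a+b: a\in A,b\in B\}$. Given nonempty $W,C\subseteq \mathbb{Z}$: $C$ is a complement to $W$ if $W+C=\mathbb{Z}$; a minimal complement if it is a complement but $C\setminus\{c\}$ is not for every $c\in C$. $C$ is an asymptotic complement to $W$ if $\mathbb{Z}\setminus(W+C)$ is finite; a minimal asymptotic complement if it is an asymptotic complement but $C\setminus\{c\}$ is not for every $c\in C$. *)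

theory Defs
  imports Complex_Main "HOL-Library.Set_Algebras"
begin

text \<open>Here \<open>W + C\<close> is the sumset of \<open>HOL-Library.Set_Algebras\<close>, that is
  \<open>{a + b | a b. a \<in> W \<and> b \<in> C}\<close>.\<close>

definition is_complement :: "int set \<Rightarrow> int set \<Rightarrow> bool" where
  "is_complement W C \<longleftrightarrow> W \<noteq> {} \<and> C \<noteq> {} \<and> W + C = UNIV"

definition is_minimal_complement :: "int set \<Rightarrow> int set \<Rightarrow> bool" where
  "is_minimal_complement W C \<longleftrightarrow>
     is_complement W C \<and> (\<forall>c\<in>C. \<not> is_complement W (C - {c}))"

definition is_asymptotic_complement :: "int set \<Rightarrow> int set \<Rightarrow> bool" where
  "is_asymptotic_complement W C \<longleftrightarrow> W \<noteq> {} \<and> C \<noteq> {} \<and> finite (UNIV - (W + C))"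

definition is_minimal_asymptotic_complement :: "int set \<Rightarrow> int set \<Rightarrow> bool" where
  "is_minimal_asymptotic_complement W C \<longleftrightarrow>
     is_asymptotic_complement W C \<and> (\<forall>c\<in>C. \<not> is_asymptotic_complement W (C - {c}))"

end

theory Submission imports Defs begin

text \<open>Since the gaps between consecutive missing positive integers tend to infinity, for fixed
  \<open>d > 0\<close> only finitely many \<open>n \<ge> 1\<close> have both \<open>n\<close> and \<open>n + d\<close> missing from \<open>W\<close>. As \<open>W\<close> is
  bounded below, any (asymptotic) complement \<open>C\<close> is unbounded below. In the asymptotic case, two
  elements of \<open>C - {c}\<close> already cover all large integers, and \<open>W + {c}\<close> is bounded below, so
  removing \<open>c\<close> loses only finitely many integers. If \<open>C\<close> were a minimal complement, distinct
  \<open>c\<close>, \<open>c'\<close> would be the only elements representing certain integers \<open>x < y\<close>; then, for the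
  infinitely many other negative \<open>e \<in> C\<close>, both \<open>x - e\<close> and \<open>y - e\<close> are missing from \<open>W\<close>,
  at the fixed distance \<open>y - x\<close>.\<close>

text \<open>From some index on, even the next value of \<open>w\<close> lies beyond distance
  \<open>d\<close>, so only the finitely many earlier values can have a partner.\<close>

lemma finite_pairs_at_fixed_distance:
  fixes w :: "nat \<Rightarrow> int" and d :: int
  assumes mono: "strict_mono w"
    and gaps: "filterlim (\<lambda>i. w (Suc i) - w i) at_top sequentially"
    and "d > 0"
  shows "finite {n \<in> range w. n + d \<in> range w}"
proof -
  \<comment> \<open>The bound is \<open>d + 1\<close> because a gap of exactly \<open>d\<close>
    would still give a pair.\<close>
  obtain I where I: "\<And>i. i \<ge> I \<Longrightarrow> w (Suc i) - w i \<ge> d + 1"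
    using gaps unfolding filterlim_at_top eventually_sequentially by blast
  have "{n \<in> range w. n + d \<in> range w} \<subseteq> w ` {..<I}"
  proof clarify
    fix i j assume j: "w i + d = w j"
    then have "i < j" using mono \<open>d > 0\<close> by (metis less_add_same_cancel1 strict_mono_less)
    then have "w (Suc i) \<le> w j" using mono by (simp add: strict_mono_less_eq)
    then have "i < I" using I[of i] j by linarith
    then show "w i \<in> w ` {..<I}" by simp
  qed
  then show ?thesis by (rule finite_subset) simp
qed

text \<open>Lower bounds for \<open>W\<close> and \<open>C\<close> add up to one for
  \<open>W + C\<close>, which would then miss a whole left ray.\<close>

lemma asymptotic_complement_unbounded_below:
  assumes "bdd_below W" and "is_asymptotic_complement W C"
  shows "\<not> bdd_below C"
proof
  assume "bdd_below C"
  then obtain k where k: "\<And>c. c \<in> C \<Longrightarrow> k \<le> c" by (auto simp: bdd_below_def)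
  obtain m where m: "\<And>w. w \<in> W \<Longrightarrow> m \<le> w" using assms(1) by (auto simp: bdd_below_def)
  have "{..<m + k} \<subseteq> UNIV - (W + C)"
  proof
    fix x assume "x \<in> {..<m + k}"
    moreover have "m + k \<le> w + c" if "w \<in> W" "c \<in> C" for w c
      using m[OF that(1)] k[OF that(2)] by (rule add_mono)
    ultimately show "x \<in> UNIV - (W + C)" by (fastforce elim: set_plus_elim)
  qed
  moreover have "infinite {..<m + k}" by (rule infinite_Iio)
  ultimately show False
    using assms(2) finite_subset unfolding is_asymptotic_complement_def by blast
qed

lemma complement_imp_asymptotic_complement:
  "is_complement W C \<Longrightarrow> is_asymptotic_complement W C"
  by (simp add: is_complement_def is_asymptotic_complement_def)

lemma unbounded_below_remove1:
  fixes C :: "int set"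
  assumes "\<not> bdd_below C"
  shows "\<not> bdd_below (C - {c})"
  using assms bdd_below_insert[of c C] bdd_below_insert[of c "C - {c}"] by simp

lemma notin_set_plusD:
  fixes W C :: "int set"
  shows "x \<notin> W + C \<Longrightarrow> c \<in> C \<Longrightarrow> x - c \<notin> W"
  by (metis diff_add_cancel set_plus_intro)

lemma no_minimal_asymptotic_complement:
  fixes W :: "int set"
  assumes bdd: "bdd_below W"
    and pairs: "\<And>d. d > 0 \<Longrightarrow> finite {n. n \<ge> 1 \<and> n \<notin> W \<and> n + d \<notin> W}"
  shows "\<not> is_minimal_asymptotic_complement W C"
proof
  assume "is_minimal_asymptotic_complement W C"
  then have C: "is_asymptotic_complement W C"
    and min: "\<And>c. c \<in> C \<Longrightarrow> \<not> is_asymptotic_complement W (C - {c})"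
    by (auto simp: is_minimal_asymptotic_complement_def)
  obtain m where m: "\<And>w. w \<in> W \<Longrightarrow> m \<le> w" using bdd by (auto simp: bdd_below_def)
  have unb: "\<not> bdd_below C" by (rule asymptotic_complement_unbounded_below[OF bdd C])
  obtain c where c: "c \<in> C" using unb by fastforce
  have unb_c: "\<not> bdd_below (C - {c})" by (rule unbounded_below_remove1[OF unb])
  then obtain b where b: "b \<in> C - {c}" by fastforce
  then obtain a where a: "a \<in> C - {c}" "a < b" using unb_c unfolding bdd_below_def
    by (meson linorder_not_le)
  let ?P = "{n. n \<ge> 1 \<and> n \<notin> W \<and> n + (b - a) \<notin> W}"
  \<comment> \<open>A newly lost \<open>x\<close> has the form \<open>w + c\<close>, so
    \<open>x \<ge> m + c\<close>. If moreover \<open>x > b\<close>, then \<open>x - b\<close> and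
    \<open>x - a\<close> are positive integers missing from \<open>W\<close>, at distance
    \<open>b - a\<close>.\<close>
  have "UNIV - (W + (C - {c})) \<subseteq> (UNIV - (W + C)) \<union> ({m + c..b} \<union> (\<lambda>n. n + b) ` ?P)"
  proof
    fix x assume "x \<in> UNIV - (W + (C - {c}))"
    then have x: "x \<notin> W + (C - {c})" by simp
    show "x \<in> (UNIV - (W + C)) \<union> ({m + c..b} \<union> (\<lambda>n. n + b) ` ?P)"
    proof (cases "x \<in> W + C")
      case True
      then obtain w e where we: "x = w + e" "w \<in> W" "e \<in> C" by (auto elim: set_plus_elim)
      then have "e = c" using x by auto
      then have lower: "m + c \<le> x" using we m by auto
      have "x - b \<notin> W" "x - b + (b - a) \<notin> W"
        using notin_set_plusD[OF x b] notin_set_plusD[OF x a(1)] by auto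
      then have "x - b \<in> ?P" if "b < x" using that by simp
      then have "x \<in> (\<lambda>n. n + b) ` ?P" if "b < x"
        using that image_eqI[of x "\<lambda>n. n + b" "x - b" ?P] by simp
      then show ?thesis using lower by (cases "b < x") auto
    qed simp
  qed
  moreover have "finite (UNIV - (W + C))" using C by (simp add: is_asymptotic_complement_def)
  moreover have "finite ?P" using pairs[of "b - a"] a by simp
  ultimately have "finite (UNIV - (W + (C - {c})))"
    by (meson finite_Un finite_atLeastAtMost_int finite_imageI finite_subset)
  then have "is_asymptotic_complement W (C - {c})"
    using C b unfolding is_asymptotic_complement_def by auto
  then show False using min c by blast
qed

lemma no_minimal_complement:
  fixes W :: "int set"
  assumes bdd: "bdd_below W"
    and pairs: "\<And>d. d > 0 \<Longrightarrow> finite {n. n \<ge> 1 \<and> n \<notin> W \<and> n + d \<notin> W}"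
  shows "\<not> is_minimal_complement W C"
proof
  assume "is_minimal_complement W C"
  then have C: "is_complement W C"
    and min: "\<And>c. c \<in> C \<Longrightarrow> \<not> is_complement W (C - {c})"
    by (auto simp: is_minimal_complement_def)
  have unb: "\<not> bdd_below C"
    using asymptotic_complement_unbounded_below[OF bdd] C
    by (blast intro: complement_imp_asymptotic_complement)
  have own_element: "\<exists>x. x \<notin> W + (C - {c})" if "c \<in> C" for c
  proof -
    \<comment> \<open>Complements are nonempty by definition, so this ensures that minimality yields
      an uncovered integer.\<close>
    have "C - {c} \<noteq> {}" using unbounded_below_remove1[OF unb, of c] by fastforce
    then show ?thesis using min[OF that] C by (auto simp: is_complement_def)
  qed
  have no_pair: False
    if x: "x \<notin> W + (C - {c})" and y: "y \<notin> W + (C - {c'})" and "x < y" for x y c c'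
  proof -
    let ?P = "{n. n \<ge> 1 \<and> n \<notin> W \<and> n + (y - x) \<notin> W}"
    let ?D = "C - {c} - {c'}"
    \<comment> \<open>For \<open>e < x\<close> the difference \<open>x - e\<close> is at least 1 and
      lies in the finite set \<open>?P\<close>; hence \<open>?D\<close> would be bounded
      below.\<close>
    have "?D \<subseteq> (\<lambda>n. x - n) ` ?P \<union> {x..}"
    proof
      fix e assume e: "e \<in> ?D"
      then have "x - e \<notin> W" "x - e + (y - x) \<notin> W"
        using notin_set_plusD[OF x, of e] notin_set_plusD[OF y, of e] by auto
      then have "x - e \<in> ?P" if "e < x" using that by simp
      then have "e \<in> (\<lambda>n. x - n) ` ?P" if "e < x"
        using that image_eqI[of e "\<lambda>n. x - n" "x - e" ?P] by simp
      then show "e \<in> (\<lambda>n. x - n) ` ?P \<union> {x..}" by (cases "e < x") auto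
    qed
    moreover have "bdd_below ((\<lambda>n. x - n) ` ?P \<union> {x..})"
      using pairs[of "y - x"] \<open>x < y\<close> by simp
    ultimately have "bdd_below ?D" by (rule bdd_below_mono[rotated])
    then show False using unbounded_below_remove1[OF unbounded_below_remove1[OF unb]] by simp
  qed
  obtain c where c: "c \<in> C" using unb by fastforce
  obtain c' where c': "c' \<in> C - {c}" using unbounded_below_remove1[OF unb, of c] by fastforce
  obtain x where x: "x \<notin> W + (C - {c})" using own_element c by blast
  obtain y where y: "y \<notin> W + (C - {c'})" using own_element c' by blast
  \<comment> \<open>Any representation \<open>x = w + e\<close> forces \<open>e = c\<close>; if
    \<open>x = y\<close>, it also forces \<open>e = c'\<close>, but
    \<open>c' \<noteq> c\<close>.\<close>
  have "x \<noteq> y"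
  proof
    assume "x = y"
    obtain w e where "x = w + e" "w \<in> W" "e \<in> C"
      using C unfolding is_complement_def by (metis UNIV_I set_plus_elim)
    then show False using x y \<open>x = y\<close> c' set_plus_intro[of w W e] by blast
  qed
  then show False using no_pair[OF x y] no_pair[OF y x] by linarith
qed

theorem theoremD:
  fixes W :: "int set" and wbar :: "nat \<Rightarrow> int"
  assumes "bdd_below W"
    and "infinite W"
    and "strict_mono wbar"
    and "range wbar = {n. n \<ge> 1} - W"
    and "filterlim (\<lambda>i. wbar (Suc i) - wbar i) at_top sequentially"
  shows "\<not> (\<exists>C. is_minimal_complement W C) \<and>
         \<not> (\<exists>C. is_minimal_asymptotic_complement W C)"
proof -
  have "finite {n. n \<ge> 1 \<and> n \<notin> W \<and> n + d \<notin> W}" if "d > 0" for d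
  proof -
    \<comment> \<open>Since \<open>d > 0\<close>, also \<open>n + d \<ge> 1\<close>, so both
      integers occur in \<open>wbar\<close>.\<close>
    have "{n. n \<ge> 1 \<and> n \<notin> W \<and> n + d \<notin> W} = {n \<in> range wbar. n + d \<in> range wbar}"
      using that unfolding assms(4) by auto
    then show ?thesis using finite_pairs_at_fixed_distance[OF assms(3,5) that] by simp
  qed
  then show ?thesis
    using no_minimal_complement[OF assms(1)] no_minimal_asymptotic_complement[OF assms(1)]
    by blast
qed

end
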